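(* Let $(X,\mathcal{B},\mu,T)$ be a probability-preserving action of a countable group $\Gamma$ on a standard probability space $(X,\mathcal{B},\mu)$ such that almost every point in $X$ has an infinite orbit. Then there exists a countable generator for the action $(X,\mathcal{B},\mu,T)$.
   Context: A probability-preserving action $(X,\mathcal{B},\mu,T)$ of $\Gamma$ is an action $\gamma \mapsto T_\gamma$ of $\Gamma$ on $X$ by measurable, $\mu$-preserving bijections of the probability space $(X,\mathcal{B},\mu)$. Here standard probability space means that $\mathcal{B}$ is the $\mu$-completion of the Borel $\sigma$-algebra of a standard Borel space carrying a Borel probability measure $\mu$, with $\Gamma$ acting by Borel automorphisms. A countable $\mu$-measurable partition $\mathcal{P} \subseteq \mathcal{B}$ (a partition of $X$ up to a $\mu$-null set into at most countably many sets) is called a generator for the action if the smallest $\mu$-complete $T$-invariant $\sigma$-algebra that contains $\mathcal{P}$ is equal to $\mathcal{B}$. *)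

theory Defs
  imports "HOL-Probability.Probability_Measure" "HOL-Algebra.Group_Action"
begin

definition standard_borel :: "'a measure \<Rightarrow> bool" where
  "standard_borel N \<longleftrightarrow>
     (\<exists>\<tau>. completely_metrizable_space \<tau> \<and> second_countable \<tau> \<and> topspace \<tau> = space N \<and>
          sets N = sigma_sets (space N) {U. openin \<tau> U})"

text \<open>
  The library's \<^const>\<open>group_action\<close> says that \<open>T\<close> is a homomorphism from \<open>G\<close> into the group of
  bijections of \<open>space M\<close>, which are represented by functions that are \<open>undefined\<close> outside
  \<open>space M\<close>. Measurability of the inverse of \<open>T g\<close> is measurability of \<open>T (inv g)\<close>.
\<close>

definition prob_preserving_action ::
    "('g, 'm) monoid_scheme \<Rightarrow> 'a measure \<Rightarrow> ('g \<Rightarrow> 'a \<Rightarrow> 'a) \<Rightarrow> bool" where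
  "prob_preserving_action G M T \<longleftrightarrow>
     prob_space M \<and> group_action G (space M) T \<and>
     (\<forall>g\<in>carrier G. T g \<in> M \<rightarrow>\<^sub>M M \<and> distr M M (T g) = M)"

text \<open>
  \<open>M\<close> is the completed space \<open>(X, \<B>, \<mu>)\<close>; \<open>N\<close> is the underlying standard Borel space with its
  Borel probability measure. A single \<open>N\<close> serves all group elements, each acting as a Borel
  automorphism of it.
\<close>

definition standard_prob_preserving_action ::
    "('g, 'm) monoid_scheme \<Rightarrow> 'a measure \<Rightarrow> ('g \<Rightarrow> 'a \<Rightarrow> 'a) \<Rightarrow> bool" where
  "standard_prob_preserving_action G M T \<longleftrightarrow>
     prob_preserving_action G M T \<and>
     (\<exists>N. standard_borel N \<and> M = completion N \<and> (\<forall>g\<in>carrier G. T g \<in> N \<rightarrow>\<^sub>M N))"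

definition countable_measurable_partition :: "'a measure \<Rightarrow> 'a set set \<Rightarrow> bool" where
  "countable_measurable_partition M \<P> \<longleftrightarrow>
     countable \<P> \<and> \<P> \<subseteq> sets M \<and> (\<exists>Z\<in>null_sets M. partition_on (space M - Z) \<P>)"

text \<open>
  Completeness of a \<open>\<sigma>\<close>-algebra is relative to the ambient measure: it contains every subset of
  every \<open>\<mu>\<close>-null set of \<open>\<B>\<close>, not only the subsets of those null sets that belong to it.
\<close>

definition complete_invariant_sigma_algebra ::
    "('g, 'm) monoid_scheme \<Rightarrow> 'a measure \<Rightarrow> ('g \<Rightarrow> 'a \<Rightarrow> 'a) \<Rightarrow> 'a set set \<Rightarrow> bool" where
  "complete_invariant_sigma_algebra G M T \<A> \<longleftrightarrow>
     sigma_algebra (space M) \<A> \<and>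
     (\<forall>Z\<in>null_sets M. \<forall>A. A \<subseteq> Z \<longrightarrow> A \<in> \<A>) \<and>
     (\<forall>g\<in>carrier G. \<forall>A\<in>\<A>. T g ` A \<in> \<A>)"

definition countable_generator ::
    "('g, 'm) monoid_scheme \<Rightarrow> 'a measure \<Rightarrow> ('g \<Rightarrow> 'a \<Rightarrow> 'a) \<Rightarrow> 'a set set \<Rightarrow> bool" where
  "countable_generator G M T \<P> \<longleftrightarrow>
     countable_measurable_partition M \<P> \<and>
     \<Inter>{\<A>. complete_invariant_sigma_algebra G M T \<A> \<and> \<P> \<subseteq> \<A>} = sets M"

end

theory Submission
  imports Defs
begin

text \<open>
  Let \<open>B\<^sub>n\<close> generate the Borel sets. Since orbits are infinite, there are sets \<open>D\<^sub>n\<close> meeting almost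
  every orbit with \<open>\<Sum>\<^sub>n \<mu>(D\<^sub>n) < \<infinity>\<close>. Move each \<open>x\<close> to the point \<open>g\<^sub>k x\<close> of \<open>D\<^sub>n\<close>, where \<open>k\<close> is minimal,
  and record there whether \<open>x \<in> B\<^sub>n\<close>. By Borel-Cantelli almost every point lies in finitely many \<open>D\<^sub>n\<close>;
  and because the action preserves \<open>\<mu>\<close>, for fixed \<open>n\<close> a point of \<open>D\<^sub>n\<close> receives on average at most
  \<open>1 / \<mu>(D\<^sub>n)\<close> records, hence almost surely finitely many. So almost every point carries a finite
  amount of information in total, and the countably many possible values partition the space.
\<close>

section \<open>Partitions from locally finite families\<close>

text \<open>The parts are the fibres of \<open>x \<mapsto> {i. x \<in> E i}\<close> over finite
  index sets. The index type is countable, so there are only countably many such sets. Off the null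
  set \<open>Z\<close>, each \<open>E i\<close> is the union of the fibres over sets containing
  \<open>i\<close>.\<close>

lemma countable_measurable_partition_of_locally_finite_family:
  fixes E :: "'i::countable \<Rightarrow> 'a set"
  assumes E: "\<And>i. E i \<in> sets M" and fin: "AE x in M. finite {i. x \<in> E i}"
  obtains \<P> Z where "countable_measurable_partition M \<P>" "Z \<in> null_sets M"
    "\<And>i. \<exists>\<Q>\<subseteq>\<P>. E i - Z = \<Union>\<Q>"
proof -
  define cell where "cell F = {x \<in> space M. {i. x \<in> E i} = F}" for F
  define \<P> where "\<P> = cell ` {F. finite F} - {{}}"
  define Z where "Z = {x \<in> space M. infinite {i. x \<in> E i}}"
  note [measurable] = E
  have cell_sets: "cell F \<in> sets M" for F
  proof -
    have "cell F = {x \<in> space M. \<forall>i. x \<in> E i \<longleftrightarrow> i \<in> F}"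
      unfolding cell_def by auto
    also have "\<dots> \<in> sets M" by measurable
    finally show ?thesis .
  qed
  have countable: "countable \<P>"
    unfolding \<P>_def by (intro countable_Diff countable_image countable_Collect_finite)
  have sets: "\<P> \<subseteq> sets M"
    unfolding \<P>_def using cell_sets by auto
  have union: "\<Union>\<P> = space M - Z"
    unfolding \<P>_def Z_def cell_def by auto
  \<comment> \<open>Measurability of \<open>Z\<close> comes from its complement, a countable union
    of measurable cells.\<close>
  have "Z = space M - \<Union>\<P>"
    unfolding union unfolding Z_def by auto
  then have "Z \<in> sets M"
    using sets.countable_Union[OF countable sets] by auto
  moreover have "AE x in M. x \<notin> Z"
    using fin by eventually_elim (auto simp: Z_def)
  ultimately have Z: "Z \<in> null_sets M"
    by (simp add: AE_iff_null_sets)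
  have "disjoint \<P>"
    unfolding \<P>_def cell_def disjoint_def by auto
  then have partition: "partition_on (space M - Z) \<P>"
    unfolding partition_on_def using union by (auto simp: \<P>_def)
  have "\<exists>\<Q>\<subseteq>\<P>. E i - Z = \<Union>\<Q>" for i
  proof (intro exI conjI)
    let ?\<Q> = "cell ` {F. finite F \<and> i \<in> F} - {{}}"
    show "?\<Q> \<subseteq> \<P>" unfolding \<P>_def by auto
    have "x \<in> E i - Z \<longleftrightarrow> x \<in> \<Union>?\<Q>" for x
    proof
      assume x: "x \<in> E i - Z"
      then have "x \<in> cell {i. x \<in> E i}" "finite {i. x \<in> E i}"
        using sets.sets_into_space[OF E[of i]] by (auto simp: cell_def Z_def)
      then show "x \<in> \<Union>?\<Q>" using x by blast
    next
      assume "x \<in> \<Union>?\<Q>"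
      then show "x \<in> E i - Z" by (force simp: cell_def Z_def)
    qed
    then show "E i - Z = \<Union>?\<Q>" by blast
  qed
  moreover have "countable_measurable_partition M \<P>"
    unfolding countable_measurable_partition_def using countable sets partition Z by blast
  ultimately show ?thesis using Z by (intro that)
qed

section \<open>A countable separating base\<close>

lemma standard_borel_countable_base:
  assumes "standard_borel N"
  obtains B :: "nat \<Rightarrow> 'a set" where "sets N = sigma_sets (space N) (range B)"
    "\<And>x y. x \<in> space N \<Longrightarrow> y \<in> space N \<Longrightarrow> (\<And>n. x \<in> B n \<longleftrightarrow> y \<in> B n) \<Longrightarrow> x = y"
proof -
  obtain \<tau> where \<tau>: "completely_metrizable_space \<tau>" "second_countable \<tau>" "topspace \<tau> = space N"
    "sets N = sigma_sets (space N) {U. openin \<tau> U}"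
    using assms unfolding standard_borel_def by blast
  obtain \<B> where \<B>: "countable \<B>" "\<And>V. V \<in> \<B> \<Longrightarrow> openin \<tau> V"
    "\<And>U x. openin \<tau> U \<Longrightarrow> x \<in> U \<Longrightarrow> \<exists>V \<in> \<B>. x \<in> V \<and> V \<subseteq> U"
    using \<tau>(2) unfolding second_countable_def by metis
  \<comment> \<open>The empty set is inserted so that the enumeration has exactly this range even if
    the base is empty.\<close>
  define B where "B = from_nat_into (insert {} \<B>)"
  have range_B: "range B = insert {} \<B>"
    unfolding B_def using \<B>(1) by (simp add: range_from_nat_into)
  have hausdorff: "Hausdorff_space \<tau>"
    using \<tau>(1) by (simp add: completely_metrizable_imp_metrizable_space metrizable_imp_Hausdorff_space)
  have "x = y" if x: "x \<in> space N" and y: "y \<in> space N" and B: "\<And>n. x \<in> B n \<longleftrightarrow> y \<in> B n" for x y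
  proof (rule ccontr)
    assume "x \<noteq> y"
    then obtain U V where "openin \<tau> U" "openin \<tau> V" "x \<in> U" "y \<in> V" "disjnt U V"
      using hausdorff x y \<tau>(3) unfolding Hausdorff_space_def by metis
    then obtain W where "W \<in> \<B>" "x \<in> W" "y \<notin> W"
      using \<B>(3)[of U x] by (auto simp: disjnt_def)
    moreover have "W \<in> range B" using range_B \<open>W \<in> \<B>\<close> by simp
    ultimately show False using B by auto
  qed
  moreover have "sigma_sets (space N) {U. openin \<tau> U} = sigma_sets (space N) (range B)"
  proof (rule sigma_sets_eqI)
    fix U assume "U \<in> {U. openin \<tau> U}"
    then have "U = \<Union>{V \<in> \<B>. V \<subseteq> U}" using \<B>(3) by blast
    moreover have "\<Union>{V \<in> \<B>. V \<subseteq> U} \<in> sigma_sets (space N) (range B)"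
      by (rule sigma_sets_UNION) (use \<B>(1) in \<open>auto simp: range_B\<close>)
    ultimately show "U \<in> sigma_sets (space N) (range B)" by simp
  next
    fix V assume "V \<in> range B"
    then show "V \<in> sigma_sets (space N) {U. openin \<tau> U}"
      using \<B>(2) by (auto simp: range_B intro: sigma_sets.Empty)
  qed
  ultimately show ?thesis using \<tau>(4) by (intro that) auto
qed

section \<open>Actions with a separating sequence of measurable sets\<close>

text \<open>The standard Borel structure enters through \<open>B\<close>: equality of two points
  becomes a countable conjunction of measurable conditions. \<open>M\<close> can then be the
  completed space.\<close>

locale separated_pmp_action = prob_space M + group_action G "space M" T
  for M :: "'a measure" and G (structure) and T +
  fixes B :: "nat \<Rightarrow> 'a set"
  assumes countable_G: "countable (carrier G)"
    and measurable_T: "g \<in> carrier G \<Longrightarrow> T g \<in> M \<rightarrow>\<^sub>M M"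
    and distr_T: "g \<in> carrier G \<Longrightarrow> distr M M (T g) = M"
    and sets_B [measurable]: "B n \<in> sets M"
    and separating: "x \<in> space M \<Longrightarrow> y \<in> space M \<Longrightarrow> (\<And>n. x \<in> B n \<longleftrightarrow> y \<in> B n) \<Longrightarrow> x = y"
begin

definition enum :: "nat \<Rightarrow> _" where
  "enum = from_nat_into (carrier G)"

lemma one_in_carrier: "\<one> \<in> carrier G"
  using group_hom by (simp add: group_hom_def group.is_monoid monoid.one_closed)

lemma inv_in_carrier: "g \<in> carrier G \<Longrightarrow> inv g \<in> carrier G"
  using group_hom by (simp add: group_hom_def group.inv_closed)

lemma range_enum: "range enum = carrier G"
  unfolding enum_def using one_in_carrier countable_G by (intro range_from_nat_into) auto

lemma enum_in_carrier [simp]: "enum k \<in> carrier G"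
  using range_enum by blast

lemma measurable_enum [measurable]: "T (enum k) \<in> M \<rightarrow>\<^sub>M M" "T (inv (enum k)) \<in> M \<rightarrow>\<^sub>M M"
  by (simp_all add: measurable_T inv_in_carrier)

lemma T_inv_enum: "x \<in> space M \<Longrightarrow> T (inv (enum k)) (T (enum k) x) = x"
  by (rule orbit_sym_aux) auto

lemma T_enum_inv:
  assumes "x \<in> space M" shows "T (enum k) (T (inv (enum k)) x) = x"
proof -
  obtain y where "y \<in> space M" "T (enum k) y = x"
    using surj_prop[OF enum_in_carrier[of k]] assms by (metis imageE)
  then show ?thesis using T_inv_enum by auto
qed

lemma orbit_eq_range: "orbit G T x = range (\<lambda>k. T (enum k) x)"
  unfolding orbit_def range_enum[symmetric] by auto

lemma orbit_subset_space: "x \<in> space M \<Longrightarrow> orbit G T x \<subseteq> space M"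
  unfolding orbit_def using element_image by auto

lemma orbit_eq:
  assumes "x \<in> space M" "y \<in> orbit G T x"
  shows "orbit G T y = orbit G T x"
proof -
  have y: "y \<in> space M" using assms orbit_subset_space by blast
  have "z \<in> orbit G T y \<longleftrightarrow> z \<in> orbit G T x" for z
    using orbit_trans[of x y z] orbit_trans[of y x z] orbit_sym[of x y] assms y
      orbit_subset_space by blast
  then show ?thesis by blast
qed

section \<open>Vanishing markers on infinite orbits\<close>

text \<open>Finiteness is expressed with countable quantifiers only: for some \<open>m\<close>, each
  orbit point in \<open>A\<close> lies in the same sets \<open>B n\<close> as one of the points
  \<open>T (enum j) x\<close> with \<open>j \<le> m\<close>, hence equals it by separation.\<close>

lemma sets_infinite_orbit_inter:
  assumes [measurable]: "A \<in> sets M"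
  shows "{x \<in> space M. infinite (orbit G T x \<inter> A)} \<in> sets M"
proof -
  have "finite (orbit G T x \<inter> A) \<longleftrightarrow>
      (\<exists>m. \<forall>i. T (enum i) x \<in> A \<longrightarrow> (\<exists>j\<in>{..m}. \<forall>n. T (enum i) x \<in> B n \<longleftrightarrow> T (enum j) x \<in> B n))"
    (is "_ \<longleftrightarrow> ?R") if x: "x \<in> space M" for x
  proof
    assume fin: "finite (orbit G T x \<inter> A)"
    obtain C where C: "finite C" "orbit G T x \<inter> A = (\<lambda>k. T (enum k) x) ` C"
      using finite_subset_image[OF fin, of "\<lambda>k. T (enum k) x" UNIV] orbit_eq_range by blast
    obtain m where "C \<subseteq> {..m}" using C(1) finite_nat_iff_bounded_le by blast
    have "\<exists>j\<in>{..m}. T (enum i) x = T (enum j) x" if "T (enum i) x \<in> A" for i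
    proof -
      have "T (enum i) x \<in> (\<lambda>k. T (enum k) x) ` C"
        unfolding C(2)[symmetric] using that orbit_eq_range by auto
      then show ?thesis using \<open>C \<subseteq> {..m}\<close> by auto
    qed
    then show ?R by metis
  next
    assume ?R
    then obtain m where m: "\<And>i. T (enum i) x \<in> A \<Longrightarrow>
        \<exists>j\<in>{..m}. \<forall>n. T (enum i) x \<in> B n \<longleftrightarrow> T (enum j) x \<in> B n" by blast
    have "T (enum i) x \<in> (\<lambda>k. T (enum k) x) ` {..m}" if "T (enum i) x \<in> A" for i
      using m[OF that] separating element_image[OF enum_in_carrier x] by blast
    then have "orbit G T x \<inter> A \<subseteq> (\<lambda>k. T (enum k) x) ` {..m}"
      unfolding orbit_eq_range by auto
    then show "finite (orbit G T x \<inter> A)" by (rule finite_subset) simp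
  qed
  then have "{x \<in> space M. infinite (orbit G T x \<inter> A)} = {x \<in> space M. \<not> (\<exists>m. \<forall>i. T (enum i) x \<in> A \<longrightarrow>
      (\<exists>j\<in>{..m}. \<forall>n. T (enum i) x \<in> B n \<longleftrightarrow> T (enum j) x \<in> B n))}"
    by blast
  also have "\<dots> \<in> sets M" by measurable
  finally show ?thesis .
qed

text \<open>
  On each infinite orbit, choose greedily a side of each \<open>B k\<close> that keeps infinitely many
  points. Since the \<open>B k\<close> separate points, at most one point of an orbit survives all the choices.
\<close>

primrec marker :: "nat \<Rightarrow> 'a set" where
  "marker 0 = space M"
| "marker (Suc k) = {x \<in> marker k. x \<in> B k \<longleftrightarrow> infinite (orbit G T x \<inter> (marker k \<inter> B k))}"

lemma sets_marker [measurable]: "marker k \<in> sets M"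
proof (induction k)
  case (Suc k)
  note Suc [measurable]
  have [measurable]: "{x \<in> space M. infinite (orbit G T x \<inter> (marker k \<inter> B k))} \<in> sets M"
    by (rule sets_infinite_orbit_inter) measurable
  have "marker (Suc k) = {x \<in> space M. x \<in> marker k \<and>
      (x \<in> B k \<longleftrightarrow> x \<in> {x \<in> space M. infinite (orbit G T x \<inter> (marker k \<inter> B k))})}"
    using sets.sets_into_space[OF Suc] by auto
  also have "\<dots> \<in> sets M" by measurable
  finally show ?case .
qed simp

lemma decseq_marker: "decseq marker"
  by (rule decseq_SucI) auto

text \<open>The choice of side depends only on the orbit, so all points of one orbit make the same
  choice. If the \<open>B k\<close> side is finite, its complement within an infinite set is
  infinite.\<close>

lemma infinite_orbit_inter_marker:
  assumes "x \<in> space M" "infinite (orbit G T x)"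
  shows "infinite (orbit G T x \<inter> marker k)"
proof (induction k)
  case 0
  then show ?case using assms orbit_subset_space by (simp add: Int_absorb2)
next
  case (Suc k)
  have eq: "orbit G T y = orbit G T x" if "y \<in> orbit G T x" for y
    using orbit_eq assms that by blast
  show ?case
  proof (cases "infinite (orbit G T x \<inter> (marker k \<inter> B k))")
    case True
    have "orbit G T x \<inter> marker (Suc k) = orbit G T x \<inter> (marker k \<inter> B k)"
      using True eq by auto
    then show ?thesis using True by simp
  next
    case False
    have "orbit G T x \<inter> marker (Suc k) = orbit G T x \<inter> marker k - orbit G T x \<inter> (marker k \<inter> B k)"
      using False eq by auto
    then show ?thesis using False Suc by (simp add: Diff_infinite_finite)
  qed
qed

text \<open>Membership in \<open>marker (Suc n)\<close> forces the answer to
  \<open>x \<in> B n\<close> to be a property of the orbit, so two survivors on one orbit agree on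
  every \<open>B n\<close>.\<close>

lemma orbit_inter_all_markers_unique:
  assumes "x \<in> space M" "y \<in> orbit G T x" "z \<in> orbit G T x"
    and "y \<in> (\<Inter>k. marker k)" "z \<in> (\<Inter>k. marker k)"
  shows "y = z"
proof (rule separating)
  show "y \<in> space M" "z \<in> space M" using assms orbit_subset_space by auto
  fix n
  have "y \<in> marker (Suc n)" "z \<in> marker (Suc n)" using assms by blast+
  then show "y \<in> B n \<longleftrightarrow> z \<in> B n" using orbit_eq assms(1-3) by simp
qed

text \<open>Removing the common part makes the sets decrease to the empty set, so their measures
  tend to 0, and costs each orbit at most one point.\<close>

definition vanishing_marker :: "nat \<Rightarrow> 'a set" where
  "vanishing_marker k = marker k - (\<Inter>k. marker k)"

lemma sets_vanishing_marker [measurable]: "vanishing_marker k \<in> sets M"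
  unfolding vanishing_marker_def by measurable

lemma vanishing_marker_meets_orbit:
  assumes "x \<in> space M" "infinite (orbit G T x)"
  shows "\<exists>i. T (enum i) x \<in> vanishing_marker k"
proof -
  let ?V = "\<Inter>k. marker k"
  have "finite (orbit G T x \<inter> ?V)"
  proof (cases "orbit G T x \<inter> ?V = {}")
    case False
    then obtain y where "y \<in> orbit G T x \<inter> ?V" by blast
    then have "orbit G T x \<inter> ?V \<subseteq> {y}"
      using orbit_inter_all_markers_unique[OF assms(1)] by blast
    then show ?thesis by (rule finite_subset) simp
  next
    case True
    then show ?thesis by simp
  qed
  \<comment> \<open>Infinitely many marked points remain after removing at most one.\<close>
  then have "infinite (orbit G T x \<inter> marker k - orbit G T x \<inter> ?V)"
    using infinite_orbit_inter_marker[OF assms] by (simp add: Diff_infinite_finite)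
  then have "orbit G T x \<inter> marker k - orbit G T x \<inter> ?V \<noteq> {}"
    using infinite_imp_nonempty by blast
  then show ?thesis unfolding vanishing_marker_def orbit_eq_range by blast
qed

lemma vanishing_marker_tendsto: "(\<lambda>k. measure M (vanishing_marker k)) \<longlonglongrightarrow> 0"
proof -
  have "decseq vanishing_marker"
    using decseq_marker unfolding decseq_def vanishing_marker_def by blast
  moreover have "(\<Inter>k. vanishing_marker k) = {}"
    unfolding vanishing_marker_def by blast
  ultimately show ?thesis
    using finite_Lim_measure_decseq[of vanishing_marker] sets_vanishing_marker by force
qed

text \<open>Measures tending to 0 allow a choice of markers dominated by a geometric series; every
  vanishing marker still meets each infinite orbit.\<close>

lemma summable_complete_sections:
  obtains D where "\<And>n. D n \<in> sets M" "summable (\<lambda>n. measure M (D n))"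
    "\<And>n x. x \<in> space M \<Longrightarrow> infinite (orbit G T x) \<Longrightarrow> \<exists>i. T (enum i) x \<in> D n"
proof -
  have "\<exists>k. measure M (vanishing_marker k) < (1/2)^n" for n
    using order_tendstoD(2)[OF vanishing_marker_tendsto, of "(1/2)^n"]
    by (auto simp: eventually_sequentially)
  then obtain k where k: "\<And>n. measure M (vanishing_marker (k n)) < (1/2)^n" by metis
  have "summable (\<lambda>n. measure M (vanishing_marker (k n)))"
    by (rule summable_comparison_test'[OF summable_geometric[of "1/2::real"], of 0])
       (auto intro: less_imp_le[OF k])
  then show ?thesis
    by (rule that[rotated]) (simp_all add: sets_vanishing_marker vanishing_marker_meets_orbit)
qed

section \<open>Recording sets on sections\<close>

definition first_hit :: "'a set \<Rightarrow> nat \<Rightarrow> 'a set" where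
  "first_hit D k = {x \<in> space M. T (enum k) x \<in> D \<and> (\<forall>j<k. T (enum j) x \<notin> D)}"

lemma sets_first_hit [measurable]:
  assumes [measurable]: "D \<in> sets M" shows "first_hit D k \<in> sets M"
  unfolding first_hit_def by measurable

lemma disjoint_first_hit: "disjoint_family (first_hit D)"
  unfolding disjoint_family_on_def first_hit_def
  by (auto, metis linorder_neqE_nat)

lemma first_hit_cover: "x \<in> space M \<Longrightarrow> T (enum i) x \<in> D \<Longrightarrow> \<exists>k. x \<in> first_hit D k"
  unfolding first_hit_def using exists_least_iff[of "\<lambda>i. T (enum i) x \<in> D"] by blast

text \<open>This is the image of \<open>first_hit D k \<inter> A\<close> under
  \<open>T (enum k)\<close>, written as a preimage under the inverse so that measurability and
  measure are immediate.\<close>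

definition code :: "'a set \<Rightarrow> 'a set \<Rightarrow> nat \<Rightarrow> 'a set" where
  "code D A k = T (inv (enum k)) -` (first_hit D k \<inter> A) \<inter> space M"

lemma sets_code:
  assumes [measurable]: "D \<in> sets M" "A \<in> sets M" shows "code D A k \<in> sets M"
  unfolding code_def by measurable

lemma code_subset: "code D A k \<subseteq> D"
  unfolding code_def first_hit_def using T_enum_inv by auto

text \<open>The decoding step: an invariant \<sigma>-algebra containing a code also contains the
  piece of \<open>A\<close> recorded by it.\<close>

lemma image_code: "T (inv (enum k)) ` code D A k = first_hit D k \<inter> A"
proof
  show "T (inv (enum k)) ` code D A k \<subseteq> first_hit D k \<inter> A"
    unfolding code_def by auto
  show "first_hit D k \<inter> A \<subseteq> T (inv (enum k)) ` code D A k"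
  proof
    fix x assume x: "x \<in> first_hit D k \<inter> A"
    then have "x \<in> space M" unfolding first_hit_def by auto
    then have "T (enum k) x \<in> code D A k" "T (inv (enum k)) (T (enum k) x) = x"
      using x T_inv_enum element_image[OF enum_in_carrier] unfolding code_def by auto
    then show "x \<in> T (inv (enum k)) ` code D A k" by force
  qed
qed

text \<open>The summands are the measures of the disjoint sets \<open>first_hit D k \<inter> A\<close>.\<close>

lemma summable_measure_code:
  assumes [measurable]: "D \<in> sets M" "A \<in> sets M"
  shows "summable (\<lambda>k. measure M (code D A k))"
proof -
  have "measure M (code D A k) = measure M (first_hit D k \<inter> A)" for k
    using measure_distr[of "T (inv (enum k))" M M "first_hit D k \<inter> A"]
      distr_T[of "inv (enum k)"] inv_in_carrier[of "enum k"]
    unfolding code_def by simp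
  moreover have "summable (\<lambda>k. measure M (first_hit D k \<inter> A))"
    by (rule sums_summable[OF finite_measure_UNION])
       (use disjoint_first_hit[of D] in \<open>auto simp: disjoint_family_on_def\<close>)
  ultimately show ?thesis by simp
qed

text \<open>Borel-Cantelli is applied once over \<open>n\<close> to the sections, and for each
  \<open>n\<close> once over \<open>k\<close> to the codes.\<close>

lemma AE_finite_codes:
  assumes D: "\<And>n. D n \<in> sets M" "summable (\<lambda>n. measure M (D n))"
  shows "AE x in M. finite {(n, k). x \<in> code (D n) (B n) k}"
proof -
  have borel_cantelli: "AE x in M. finite {n. x \<in> A n}"
    if A: "\<And>n. A n \<in> sets M" "summable (\<lambda>n. measure M (A n))" for A :: "nat \<Rightarrow> 'a set"
  proof -
    have "AE x in M. eventually (\<lambda>n. x \<in> space M - A n) sequentially"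
      by (rule borel_cantelli_AE1) (use A in \<open>simp_all add: emeasure_eq_measure\<close>)
    then show ?thesis
    proof eventually_elim
      case (elim x)
      then have "finite {n. x \<notin> space M - A n}"
        by (simp add: cofinite_eq_sequentially[symmetric] eventually_cofinite)
      then show ?case by (rule rev_finite_subset) auto
    qed
  qed
  have "AE x in M. finite {n. x \<in> D n}"
    by (rule borel_cantelli[OF D])
  moreover have "AE x in M. \<forall>n. finite {k. x \<in> code (D n) (B n) k}"
    unfolding AE_all_countable
    using borel_cantelli sets_code[OF D(1) sets_B] summable_measure_code[OF D(1) sets_B] by blast
  ultimately show ?thesis
  proof eventually_elim
    case (elim x)
    \<comment> \<open>Codes lie inside their section, so only the finitely many \<open>n\<close>
      with \<open>x \<in> D n\<close> contribute, each with finitely many \<open>k\<close>.\<close>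
    have "{(n, k). x \<in> code (D n) (B n) k} \<subseteq> (SIGMA n:{n. x \<in> D n}. {k. x \<in> code (D n) (B n) k})"
      using code_subset by auto
    then show ?case using elim by (auto intro: finite_subset)
  qed
qed

section \<open>Recovering the base from the partition\<close>

lemma partition_determining_base:
  assumes "AE x in M. infinite (orbit G T x)"
  obtains \<P> where "countable_measurable_partition M \<P>"
    "\<And>\<A> n. complete_invariant_sigma_algebra G M T \<A> \<Longrightarrow> \<P> \<subseteq> \<A> \<Longrightarrow> B n \<in> \<A>"
proof -
  obtain D where D: "\<And>n. D n \<in> sets M" "summable (\<lambda>n. measure M (D n))"
    "\<And>n x. x \<in> space M \<Longrightarrow> infinite (orbit G T x) \<Longrightarrow> \<exists>i. T (enum i) x \<in> D n"
    using summable_complete_sections by blast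
  define E where "E = (\<lambda>(n, k). code (D n) (B n) k)"
  have sets_E: "E i \<in> sets M" for i
    unfolding E_def by (auto split: prod.split intro: sets_code D)
  have fin: "AE x in M. finite {i. x \<in> E i}"
    using AE_finite_codes[OF D(1,2)] by (simp add: E_def case_prod_unfold)
  obtain \<P> Z where \<P>: "countable_measurable_partition M \<P>" and Z: "Z \<in> null_sets M"
    and EP: "\<And>i. \<exists>\<Q>\<subseteq>\<P>. E i - Z = \<Union>\<Q>"
    using countable_measurable_partition_of_locally_finite_family[of E M, OF sets_E fin] by metis
  have "B n \<in> \<A>" if \<A>: "complete_invariant_sigma_algebra G M T \<A>" and "\<P> \<subseteq> \<A>" for \<A> n
  proof -
    interpret \<A>: sigma_algebra "space M" \<A>
      using \<A> unfolding complete_invariant_sigma_algebra_def by blast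
    have null: "\<And>A Z. Z \<in> null_sets M \<Longrightarrow> A \<subseteq> Z \<Longrightarrow> A \<in> \<A>"
      and inva: "\<And>g A. g \<in> carrier G \<Longrightarrow> A \<in> \<A> \<Longrightarrow> T g ` A \<in> \<A>"
      using \<A> unfolding complete_invariant_sigma_algebra_def by blast+
    have E_in: "E i \<in> \<A>" for i
    proof -
      obtain \<Q> where \<Q>: "\<Q> \<subseteq> \<P>" "E i - Z = \<Union>\<Q>" using EP by blast
      have "countable \<Q>"
        using \<P> \<Q>(1) countable_subset unfolding countable_measurable_partition_def by blast
      then have "\<Union>\<Q> \<in> \<A>" using \<Q>(1) \<open>\<P> \<subseteq> \<A>\<close> by (intro \<A>.countable_Union) auto
      \<comment> \<open>Completeness of \<open>\<A>\<close> supplies the part of the code that the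
        cells miss.\<close>
      moreover have "E i \<inter> Z \<in> \<A>" using null[OF Z] by blast
      moreover have "E i = \<Union>\<Q> \<union> (E i \<inter> Z)" using \<Q>(2) by blast
      ultimately show ?thesis by (metis \<A>.Un)
    qed
    have hit_in: "first_hit (D n) k \<inter> B n \<in> \<A>" for k
      using inva[OF inv_in_carrier[OF enum_in_carrier[of k]] E_in[of "(n, k)"]]
      by (simp add: E_def image_code)
    \<comment> \<open>Points with finite orbit may never reach \<open>D n\<close>. They are confined
      to the null set \<open>Y\<close>, so the first-hit pieces cover \<open>B n\<close> outside
      \<open>Y\<close>.\<close>
    obtain Y where Y: "Y \<in> null_sets M" "{x \<in> space M. \<not> infinite (orbit G T x)} \<subseteq> Y"
      using assms unfolding eventually_ae_filter by auto
    have "B n = (\<Union>k. first_hit (D n) k \<inter> B n) \<union> (B n \<inter> Y)"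
    proof -
      have "x \<in> Y \<or> (\<exists>k. x \<in> first_hit (D n) k)" if "x \<in> B n" for x
      proof (cases "infinite (orbit G T x)")
        case True
        have "x \<in> space M" using sets.sets_into_space[OF sets_B] that by blast
        then show ?thesis using D(3)[OF _ True] first_hit_cover by metis
      next
        case False
        then show ?thesis using sets.sets_into_space[OF sets_B] that Y(2) by blast
      qed
      then show ?thesis by blast
    qed
    moreover have "(\<Union>k. first_hit (D n) k \<inter> B n) \<in> \<A>"
      by (rule \<A>.countable_UN) (use hit_in in blast)
    moreover have "B n \<inter> Y \<in> \<A>" using null[OF Y(1)] by blast
    ultimately show ?thesis by (metis \<A>.Un)
  qed
  then show ?thesis using \<P> by (intro that)
qed

text \<open>The image under \<open>T g\<close> is the preimage under the inverse. This makes
  \<open>sets M\<close> itself an invariant \<sigma>-algebra, the upper bound for the one generated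
  by the partition.\<close>

lemma image_in_sets:
  assumes "g \<in> carrier G" "A \<in> sets M"
  shows "T g ` A \<in> sets M"
proof -
  obtain k where k: "g = enum k" using assms range_enum by blast
  have A: "A \<subseteq> space M" by (rule sets.sets_into_space[OF assms(2)])
  have "x \<in> T g ` A \<longleftrightarrow> x \<in> T (inv g) -` A \<inter> space M" for x
  proof
    assume "x \<in> T g ` A"
    then obtain a where a: "a \<in> A" "x = T g a" by blast
    then have "T (inv g) x = a" using T_inv_enum[of a k] A k by auto
    then show "x \<in> T (inv g) -` A \<inter> space M"
      using a A element_image[OF assms(1), of a x] by auto
  next
    assume x: "x \<in> T (inv g) -` A \<inter> space M"
    then have "x = T g (T (inv g) x)" using T_enum_inv[of x k] k by simp
    then show "x \<in> T g ` A" using x by (metis IntD1 imageI vimageD)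
  qed
  then have "T g ` A = T (inv g) -` A \<inter> space M" by blast
  then show ?thesis using measurable_sets[OF measurable_T[OF inv_in_carrier] assms(2)] assms(1) by simp
qed

end

section \<open>Passage to the completed \<sigma>-algebra\<close>

theorem theorem5p3:
  fixes G :: "('g, 'm) monoid_scheme" and M :: "'a measure" and T :: "'g \<Rightarrow> 'a \<Rightarrow> 'a"
  assumes "countable (carrier G)"
    and "standard_prob_preserving_action G M T"
    and "AE x in M. infinite (orbit G T x)"
  shows "\<exists>\<P>. countable_generator G M T \<P>"
proof -
  obtain N where N: "standard_borel N" "M = completion N"
    using assms(2) unfolding standard_prob_preserving_action_def by blast
  have pmp: "prob_space M" "group_action G (space M) T"
    "\<And>g. g \<in> carrier G \<Longrightarrow> T g \<in> M \<rightarrow>\<^sub>M M \<and> distr M M (T g) = M"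
    using assms(2) unfolding standard_prob_preserving_action_def prob_preserving_action_def by blast+
  obtain B :: "nat \<Rightarrow> 'a set" where B: "sets N = sigma_sets (space N) (range B)"
    "\<And>x y. x \<in> space N \<Longrightarrow> y \<in> space N \<Longrightarrow> (\<And>n. x \<in> B n \<longleftrightarrow> y \<in> B n) \<Longrightarrow> x = y"
    using standard_borel_countable_base[OF N(1)] by blast
  have sets_B: "B n \<in> sets M" for n
    using B(1) N(2) by (auto intro: sets_completionI_sets)
  interpret prob_space M by fact
  interpret group_action G "space M" T by fact
  interpret separated_pmp_action M G T B
    by unfold_locales (use assms(1) pmp(3) sets_B B(2) N(2) in auto)
  obtain \<P> where \<P>: "countable_measurable_partition M \<P>"
    "\<And>\<A> n. complete_invariant_sigma_algebra G M T \<A> \<Longrightarrow> \<P> \<subseteq> \<A> \<Longrightarrow> B n \<in> \<A>"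
    using partition_determining_base[OF assms(3)] by blast
  have "complete_invariant_sigma_algebra G M T (sets M)"
    unfolding complete_invariant_sigma_algebra_def
    using sets.sigma_algebra_axioms image_in_sets completion.complete[where M = N] N(2) by blast
  moreover have "\<P> \<subseteq> sets M"
    using \<P>(1) unfolding countable_measurable_partition_def by blast
  moreover have "sets M \<subseteq> \<A>"
    if \<A>: "complete_invariant_sigma_algebra G M T \<A>" and "\<P> \<subseteq> \<A>" for \<A>
  proof
    fix A assume "A \<in> sets M"
    \<comment> \<open>A set of the completion is a Borel set \<open>S\<close> together with a subset
      \<open>Y\<close> of a Borel null set. The sets \<open>B n\<close> generate \<open>S\<close>,
      and completeness of \<open>\<A>\<close> gives \<open>Y\<close>.\<close>
    then obtain S Y Y' where S: "A = S \<union> Y" "Y \<subseteq> Y'" "Y' \<in> null_sets N" "S \<in> sets N"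
      unfolding N(2) by (rule sets_completionE)
    interpret \<A>: sigma_algebra "space M" \<A>
      using \<A> unfolding complete_invariant_sigma_algebra_def by blast
    have "sets N \<subseteq> \<A>"
      unfolding B(1) using \<A>.sigma_sets_subset[of "range B"] \<P>(2)[OF that] N(2) by auto
    moreover have "Y \<in> \<A>"
      using \<A> S(2) null_sets_completionI[OF S(3)] N(2)
      unfolding complete_invariant_sigma_algebra_def by blast
    ultimately show "A \<in> \<A>" using S by auto
  qed
  ultimately have "\<Inter>{\<A>. complete_invariant_sigma_algebra G M T \<A> \<and> \<P> \<subseteq> \<A>} = sets M"
    by blast
  then show ?thesis using \<P>(1) unfolding countable_generator_def by blast
qed

end
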